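(* Let $V$ and $W$ be dense, countable, i.d.f. subsets of $c$. If $G$ and $H$ are g.e.c. geometric $1$-graphs with vertex sets $V$ and $W$, respectively, then $G\cong H$.
   Context: $c$ is the Banach space of convergent real sequences $x=(x_n)_{n\in\mathbb N}$ with $\|x\|=\sup_n|x_n|$; $x_\infty=\lim_nx_n$. A subset $A\subseteq c$ is i.d.f. if for all $n\in\mathbb N\cup\{\infty\}$: $x_n\notin\mathbb Z$ for all $x\in A$ and $x_n-y_n\notin\mathbb Z$ for all distinct $x,y\in A$. For $x$ in a normed space, $B_1(x)=\{u\colon\|u-x\|<1\}$. A graph $G$ whose vertex set $V$ is a subset of a normed space is g.e.c. (geometrically existentially closed at level $1$) if for every $\delta'\in(0,1)$, every $x\in V$, and all disjoint finite $A,B\subseteq V$ with $A\cup B\subseteq B_1(x)$, there is a vertex $z\in V\setminus(A\cup B\cup\{x\})$ adjacent to every vertex of $A$ and to no vertex of $B$, with $A\cup B\subseteq B_1(z)$ and $\|x-z\|<\delta'$. $G$ has threshold $1$ if $\|u-v\|<1$ for every edge $uv$. A geometric $1$-graph is a countable graph (with vertex set in the normed space) that is g.e.c. and has threshold $1$. *)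

theory Defs
  imports "HOL-Analysis.Analysis"
begin

section \<open>The Banach space \<open>c\<close>\<close>

text \<open>
  The type \<open>nat\<close> is discrete, so \<open>nat \<Rightarrow>\<^sub>C real\<close> is the space of all bounded real sequences
  with the supremum norm. The space \<open>c\<close> is its subset of convergent sequences, with the
  inherited norm. Density of a set in \<open>c\<close> is relative to \<open>c\<close>, not to the ambient type.
\<close>

definition c_space :: "(nat \<Rightarrow>\<^sub>C real) set" where
  "c_space = {x. convergent (apply_bcontfun x)}"

definition dense_in_c :: "(nat \<Rightarrow>\<^sub>C real) set \<Rightarrow> bool" where
  "dense_in_c V \<longleftrightarrow> V \<subseteq> c_space \<and> c_space \<subseteq> closure V"

lemma norm_seq_eq_SUP: "norm (x :: nat \<Rightarrow>\<^sub>C real) = (SUP n. \<bar>apply_bcontfun x n\<bar>)"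
  unfolding norm_bcontfun_def by (simp add: dist_bcontfun.rep_eq)

lemma convergent_imp_c_space:
  assumes "convergent f"
  obtains x where "x \<in> c_space" "apply_bcontfun x = f"
proof -
  have "bounded (range f)"
    using assms by (auto simp: convergent_def intro: convergent_imp_bounded)
  then have "f \<in> bcontfun"
    by (simp add: bcontfun_def)
  then have "apply_bcontfun (Bcontfun f) = f"
    by (rule Bcontfun_inverse)
  then show thesis
    using that[of "Bcontfun f"] assms by (simp add: c_space_def)
qed

lemma subspace_c_space: "subspace c_space"
  unfolding subspace_def c_space_def
  by (auto intro: convergent_add convergent_mult simp: convergent_const)

lemma closed_c_space: "closed c_space"
  unfolding closed_sequential_limits
proof (intro allI impI, elim conjE)
  fix s :: "nat \<Rightarrow> nat \<Rightarrow>\<^sub>C real" and l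
  assume s: "\<forall>n. s n \<in> c_space" and lim: "s \<longlonglongrightarrow> l"
  have "Cauchy (apply_bcontfun l)"
  proof (rule metric_CauchyI)
    fix e :: real assume "e > 0"
    then obtain k where k: "dist (s k) l < e / 3"
      using lim by (meson divide_pos_pos lim_sequentially order_refl zero_less_numeral)
    have "Cauchy (apply_bcontfun (s k))"
      using s by (simp add: c_space_def convergent_Cauchy)
    then obtain M where M: "\<And>m n. m \<ge> M \<Longrightarrow> n \<ge> M \<Longrightarrow> dist (s k m) (s k n) < e / 3"
      using \<open>e > 0\<close> by (meson divide_pos_pos metric_CauchyD zero_less_numeral)
    have "dist (l m) (l n) < e" if "m \<ge> M" "n \<ge> M" for m n
      using M[OF that] k dist_bounded[of "s k" m l] dist_bounded[of "s k" n l]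
      unfolding dist_real_def by argo
    then show "\<exists>M. \<forall>m\<ge>M. \<forall>n\<ge>M. dist (l m) (l n) < e"
      by blast
  qed
  then show "l \<in> c_space"
    by (simp add: c_space_def Cauchy_convergent_iff)
qed

text \<open>The coordinates \<open>x\<^sub>n\<close> for \<open>n \<in> \<nat> \<union> {\<infinity>}\<close>, where \<open>x\<^sub>\<infinity>\<close> is the limit of the sequence.\<close>

definition coord :: "(nat \<Rightarrow>\<^sub>C real) \<Rightarrow> enat \<Rightarrow> real" where
  "coord x n = (case n of enat k \<Rightarrow> apply_bcontfun x k | \<infinity> \<Rightarrow> lim (apply_bcontfun x))"

definition idf :: "(nat \<Rightarrow>\<^sub>C real) set \<Rightarrow> bool" where
  "idf A \<longleftrightarrow> A \<subseteq> c_space \<and>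
     (\<forall>n. (\<forall>x\<in>A. coord x n \<notin> \<int>) \<and>
          (\<forall>x\<in>A. \<forall>y\<in>A. x \<noteq> y \<longrightarrow> coord x n - coord y n \<notin> \<int>))"


section \<open>Graphs on subsets of a normed space\<close>

record 'a sgraph =
  verts :: "'a set"
  edges :: "'a set set"

text \<open>Simple undirected graphs, not necessarily finite.\<close>

definition is_graph :: "'a sgraph \<Rightarrow> bool" where
  "is_graph G \<longleftrightarrow> edges G \<subseteq> {{u, v} | u v. u \<in> verts G \<and> v \<in> verts G \<and> u \<noteq> v}"

definition adjacent :: "'a sgraph \<Rightarrow> 'a \<Rightarrow> 'a \<Rightarrow> bool" where
  "adjacent G u v \<longleftrightarrow> {u, v} \<in> edges G"

definition graph_isomorphic :: "'a sgraph \<Rightarrow> 'b sgraph \<Rightarrow> bool" where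
  "graph_isomorphic G H \<longleftrightarrow>
     (\<exists>f. bij_betw f (verts G) (verts H) \<and>
          (\<forall>u\<in>verts G. \<forall>v\<in>verts G. adjacent G u v \<longleftrightarrow> adjacent H (f u) (f v)))"

text \<open>Geometrically existentially closed at level \<open>1\<close>.\<close>

definition gec :: "'a::real_normed_vector sgraph \<Rightarrow> bool" where
  "gec G \<longleftrightarrow>
     (\<forall>\<delta>::real. 0 < \<delta> \<and> \<delta> < 1 \<longrightarrow>
       (\<forall>x\<in>verts G. \<forall>A B.
          A \<subseteq> verts G \<and> B \<subseteq> verts G \<and> finite A \<and> finite B \<and> A \<inter> B = {} \<and> A \<union> B \<subseteq> ball x 1 \<longrightarrow>
          (\<exists>z \<in> verts G - (A \<union> B \<union> {x}).
             (\<forall>a\<in>A. adjacent G z a) \<and> (\<forall>b\<in>B. \<not> adjacent G z b) \<and>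
             A \<union> B \<subseteq> ball z 1 \<and> norm (x - z) < \<delta>)))"

definition threshold_1 :: "'a::real_normed_vector sgraph \<Rightarrow> bool" where
  "threshold_1 G \<longleftrightarrow>
     (\<forall>u\<in>verts G. \<forall>v\<in>verts G. adjacent G u v \<longrightarrow> norm (u - v) < 1)"

definition geometric_1_graph :: "'a::real_normed_vector sgraph \<Rightarrow> bool" where
  "geometric_1_graph G \<longleftrightarrow> is_graph G \<and> countable (verts G) \<and> gec G \<and> threshold_1 G"

end

theory Submission
  imports Defs
begin

text \<open>
  The isomorphism is built by a back-and-forth argument over finite partial maps \<open>y \<mapsto> v\<close> that
  preserve adjacency and, in every coordinate \<open>n \<in> \<nat> \<union> {\<infinity>}\<close>, the integer part of differences. As
  differences are never integers, and a sequence in \<open>c\<close> has norm below \<open>1\<close> iff all its coordinates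
  (including the limit) do, such maps also preserve the relation \<open>\<parallel>x - y\<parallel> < 1\<close>.
  To extend the map to a new vertex \<open>x\<close>, put \<open>k = \<lfloor>x\<^sub>n - y\<^sub>n\<rfloor>\<close>: the intervals
  \<open>(v\<^sub>n + k, v\<^sub>n + k + 1)\<close> have a common point for each \<open>n\<close>, and such points can be chosen to form a
  convergent sequence with uniform room around it, because \<open>x\<^sub>\<infinity> - y\<^sub>\<infinity>\<close> is not an integer.
  Density supplies a vertex in this room, and existential closure moves it slightly to one with
  the right adjacencies.
\<close>

section \<open>Back and forth\<close>

text \<open>\<open>Q\<close> constrains only two pairs of a relation at a time, so it survives the
  union of an increasing chain of finite relations. Assumption \<open>Q\<close> makes that union
  single-valued and injective; \<open>total\<close> and \<open>onto\<close> let the chain exhaust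
  both sets.\<close>

lemma back_and_forth:
  fixes V :: "'a set" and W :: "'b set" and Q :: "'a \<times> 'b \<Rightarrow> 'a \<times> 'b \<Rightarrow> bool"
  assumes "countable V" "countable W"
    and Q: "\<And>p q. Q p q \<Longrightarrow> fst p = fst q \<longleftrightarrow> snd p = snd q"
    and total: "\<And>S x. \<lbrakk>finite S; S \<subseteq> V \<times> W; \<forall>p\<in>S. \<forall>q\<in>S. Q p q; x \<in> V; x \<notin> fst ` S\<rbrakk>
      \<Longrightarrow> \<exists>w\<in>W. \<forall>p\<in>insert (x, w) S. \<forall>q\<in>insert (x, w) S. Q p q"
    and onto: "\<And>S w. \<lbrakk>finite S; S \<subseteq> V \<times> W; \<forall>p\<in>S. \<forall>q\<in>S. Q p q; w \<in> W; w \<notin> snd ` S\<rbrakk>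
      \<Longrightarrow> \<exists>x\<in>V. \<forall>p\<in>insert (x, w) S. \<forall>q\<in>insert (x, w) S. Q p q"
  shows "\<exists>f. bij_betw f V W \<and> (\<forall>x\<in>V. \<forall>y\<in>V. Q (x, f x) (y, f y))"
proof -
  define good where "good S \<longleftrightarrow> finite S \<and> S \<subseteq> V \<times> W \<and> (\<forall>p\<in>S. \<forall>q\<in>S. Q p q)" for S
  \<comment> \<open>Stage \<open>n\<close> is responsible for the element of index \<open>n\<close>
    on each side. The implications make a stage vacuous on a side that has no such element.\<close>
  define covers where "covers n S \<longleftrightarrow> (\<forall>x\<in>V. to_nat_on V x = n \<longrightarrow> x \<in> fst ` S) \<and>
    (\<forall>w\<in>W. to_nat_on W w = n \<longrightarrow> w \<in> snd ` S)" for n :: nat and S :: "('a \<times> 'b) set"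
  have dom: "\<exists>T. good T \<and> S \<subseteq> T \<and> x \<in> fst ` T" if "good S" "x \<in> V" for S x
  proof (cases "x \<in> fst ` S")
    case False
    with that obtain w where "w \<in> W" "\<forall>p\<in>insert (x, w) S. \<forall>q\<in>insert (x, w) S. Q p q"
      using total[of S x] unfolding good_def by blast
    with that show ?thesis
      by (intro exI[of _ "insert (x, w) S"]) (auto simp: good_def)
  qed (use that in blast)
  have ran: "\<exists>T. good T \<and> S \<subseteq> T \<and> w \<in> snd ` T" if "good S" "w \<in> W" for S w
  proof (cases "w \<in> snd ` S")
    case False
    with that obtain x where "x \<in> V" "\<forall>p\<in>insert (x, w) S. \<forall>q\<in>insert (x, w) S. Q p q"
      using onto[of S w] unfolding good_def by blast
    with that show ?thesis
      by (intro exI[of _ "insert (x, w) S"]) (auto simp: good_def)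
  qed (use that in blast)
  have step: "\<exists>T. good T \<and> S \<subseteq> T \<and> covers n T" if S: "good S" for S n
  proof -
    have "\<exists>T. good T \<and> S \<subseteq> T \<and> (\<forall>x\<in>V. to_nat_on V x = n \<longrightarrow> x \<in> fst ` T)"
    proof (cases "\<exists>x\<in>V. to_nat_on V x = n")
      case True
      then obtain x where x: "x \<in> V" "to_nat_on V x = n" by blast
      obtain T where "good T" "S \<subseteq> T" "x \<in> fst ` T" using dom[OF S x(1)] by blast
      moreover have "x' = x" if "x' \<in> V" "to_nat_on V x' = n" for x'
        using that x \<open>countable V\<close> by (metis to_nat_on_inj)
      ultimately show ?thesis by metis
    qed (use S in blast)
    then obtain T where T: "good T" "S \<subseteq> T" "\<forall>x\<in>V. to_nat_on V x = n \<longrightarrow> x \<in> fst ` T" by blast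
    have "\<exists>U. good U \<and> T \<subseteq> U \<and> (\<forall>w\<in>W. to_nat_on W w = n \<longrightarrow> w \<in> snd ` U)"
    proof (cases "\<exists>w\<in>W. to_nat_on W w = n")
      case True
      then obtain w where w: "w \<in> W" "to_nat_on W w = n" by blast
      obtain U where "good U" "T \<subseteq> U" "w \<in> snd ` U" using ran[OF T(1) w(1)] by blast
      moreover have "w' = w" if "w' \<in> W" "to_nat_on W w' = n" for w'
        using that w \<open>countable W\<close> by (metis to_nat_on_inj)
      ultimately show ?thesis by metis
    qed (use T in blast)
    then obtain U where U: "good U" "T \<subseteq> U" "\<forall>w\<in>W. to_nat_on W w = n \<longrightarrow> w \<in> snd ` U" by blast
    have "covers n U"
      unfolding covers_def using T(3) U(2,3) by blast
    then show ?thesis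
      using T U by blast
  qed
  have "\<exists>F. \<forall>n. good (F n) \<and> F n \<subseteq> F (Suc n) \<and> covers n (F (Suc n))"
  proof (rule dependent_nat_choice[where P = "\<lambda>_. good" and Q = "\<lambda>n S T. S \<subseteq> T \<and> covers n T",
        THEN exE])
    show "\<exists>S. good S" by (intro exI[of _ "{}"]) (simp add: good_def)
  qed (use step in blast)+
  then obtain F where F: "\<And>n. good (F n)" "\<And>n. F n \<subseteq> F (Suc n)" "\<And>n. covers n (F (Suc n))"
    by blast
  define R where "R = (\<Union>n. F n)"
  have R_sub: "R \<subseteq> V \<times> W"
    using F(1) unfolding R_def good_def by blast
  \<comment> \<open>Two pairs of the union already lie together in one finite stage.\<close>
  have R_Q: "Q p q" if pq: "p \<in> R" "q \<in> R" for p q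
  proof -
    obtain i j where "p \<in> F i" "q \<in> F j" using pq by (auto simp: R_def)
    then have "p \<in> F (max i j)" "q \<in> F (max i j)"
      using lift_Suc_mono_le[of F, OF F(2)] by (meson max.cobounded1 max.cobounded2 subsetD)+
    then show ?thesis using F(1) by (auto simp: good_def)
  qed
  have dom: "\<exists>w. (x, w) \<in> R" if "x \<in> V" for x
    using F(3)[of "to_nat_on V x"] that by (force simp: covers_def R_def)
  have ran: "\<exists>x. (x, w) \<in> R" if "w \<in> W" for w
    using F(3)[of "to_nat_on W w"] that by (force simp: covers_def R_def)
  obtain f where f: "\<And>x. x \<in> V \<Longrightarrow> (x, f x) \<in> R"
    using dom by metis
  have uniq: "x = x' \<longleftrightarrow> w = w'" if "(x, w) \<in> R" "(x', w') \<in> R" for x x' w w'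
    using Q[OF R_Q[OF that]] by simp
  have "bij_betw f V W"
    unfolding bij_betw_def
  proof
    show "inj_on f V"
      using f uniq by (metis inj_onI)
    show "f ` V = W"
    proof (intro equalityI subsetI)
      fix w assume "w \<in> W"
      then obtain x where "(x, w) \<in> R" using ran by blast
      then show "w \<in> f ` V"
        using R_sub f uniq by blast
    qed (use f R_sub in blast)
  qed
  then show ?thesis
    using f R_Q by blast
qed

section \<open>Coordinates in \<open>c\<close>\<close>

lemma coord_tendsto:
  assumes "x \<in> c_space"
  shows "(\<lambda>n. coord x (enat n)) \<longlonglongrightarrow> coord x \<infinity>"
  using assms by (simp add: coord_def c_space_def convergent_LIMSEQ_iff)

lemma coord_diff:
  assumes "x \<in> c_space" "y \<in> c_space"
  shows "coord (x - y) n = coord x n - coord y n"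
proof (cases n)
  case infinity
  have "(\<lambda>n. coord x (enat n) - coord y (enat n)) \<longlonglongrightarrow> coord x \<infinity> - coord y \<infinity>"
    using assms by (intro tendsto_diff coord_tendsto)
  then show ?thesis
    using infinity by (simp add: coord_def limI)
qed (simp add: coord_def)

lemma abs_coord_le_norm:
  assumes "x \<in> c_space"
  shows "\<bar>coord x n\<bar> \<le> norm x"
proof -
  have *: "\<bar>coord x (enat k)\<bar> \<le> norm x" for k
    using norm_bounded[of x k] by (simp add: coord_def)
  show ?thesis
  proof (cases n)
    case infinity
    have "(\<lambda>n. \<bar>coord x (enat n)\<bar>) \<longlonglongrightarrow> \<bar>coord x \<infinity>\<bar>"
      using assms by (intro tendsto_rabs coord_tendsto)
    then show ?thesis
      using infinity * by (auto intro: LIMSEQ_le_const2)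
  qed (use * in auto)
qed

lemma norm_less_iff_coord:
  assumes "x \<in> c_space"
  shows "norm x < r \<longleftrightarrow> (\<forall>n. \<bar>coord x n\<bar> < r)"
proof
  assume coord: "\<forall>n. \<bar>coord x n\<bar> < r"
  then obtain s where s: "\<bar>coord x \<infinity>\<bar> < s" "s < r"
    using dense by blast
  have "(\<lambda>n. \<bar>coord x (enat n)\<bar>) \<longlonglongrightarrow> \<bar>coord x \<infinity>\<bar>"
    using assms by (intro tendsto_rabs coord_tendsto)
  then obtain N where N: "\<And>n. n \<ge> N \<Longrightarrow> \<bar>coord x (enat n)\<bar> < s"
    using s(1) order_tendstoD(2) by (force simp: eventually_sequentially)
  \<comment> \<open>Inserting \<open>s\<close> bounds the tail and keeps the set nonempty when
    \<open>N = 0\<close>.\<close>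
  define M where "M = Max (insert s ((\<lambda>n. \<bar>coord x (enat n)\<bar>) ` {..<N}))"
  have "norm (apply_bcontfun x n) \<le> M" for n
  proof (cases "n < N")
    case False
    then have "\<bar>coord x (enat n)\<bar> \<le> s" using N[of n] by simp
    also have "s \<le> M" by (simp add: M_def)
    finally show ?thesis by (simp add: coord_def)
  next
    case True
    then have "\<bar>coord x (enat n)\<bar> \<le> M" by (simp add: M_def)
    then show ?thesis by (simp add: coord_def)
  qed
  then have "norm x \<le> M" by (rule norm_bound)
  also have "M < r" using s coord by (auto simp: M_def)
  finally show "norm x < r" .
qed (use abs_coord_le_norm[OF assms] le_less_trans in blast)

section \<open>Integer parts of coordinate differences\<close>

text \<open>The two floors describe the half-open interval from -1 to 1, whose endpoint -1 is an
  integer.\<close>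

lemma abs_less_1_iff_floor:
  fixes a :: real
  assumes "a \<notin> \<int>"
  shows "\<bar>a\<bar> < 1 \<longleftrightarrow> \<lfloor>a\<rfloor> = 0 \<or> \<lfloor>a\<rfloor> = -1"
proof -
  have "a \<noteq> -1" using assms by auto
  then show ?thesis
    by (auto simp: floor_eq_iff abs_less_iff)
qed

text \<open>Off the integers, negation sends the floor \<open>k\<close> to \<open>- k - 1\<close>.
  This gives the floors of differences taken in the opposite order.\<close>

lemma floor_minus_cong:
  fixes a b :: real
  assumes "a \<notin> \<int>" "b \<notin> \<int>" "\<lfloor>a\<rfloor> = \<lfloor>b\<rfloor>"
  shows "\<lfloor>- a\<rfloor> = \<lfloor>- b\<rfloor>"
  using assms by (simp add: floor_minus ceiling_altdef) (metis Ints_of_int)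

definition nonint_diff :: "(nat \<Rightarrow>\<^sub>C real) set \<Rightarrow> bool" where
  "nonint_diff V \<longleftrightarrow> V \<subseteq> c_space \<and>
     (\<forall>x\<in>V. \<forall>y\<in>V. \<forall>n. x \<noteq> y \<longrightarrow> coord x n - coord y n \<notin> \<int>)"

lemma norm_diff_less_1_cong:
  assumes "x \<in> c_space" "y \<in> c_space" "w \<in> c_space" "v \<in> c_space"
    and "\<And>n. coord x n - coord y n \<notin> \<int>" "\<And>n. coord w n - coord v n \<notin> \<int>"
    and "\<And>n. \<lfloor>coord x n - coord y n\<rfloor> = \<lfloor>coord w n - coord v n\<rfloor>"
  shows "norm (x - y) < 1 \<longleftrightarrow> norm (w - v) < 1"
proof -
  have "x - y \<in> c_space" "w - v \<in> c_space"
    using assms subspace_c_space subspace_diff by blast+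
  then show ?thesis
    using assms by (simp add: norm_less_iff_coord coord_diff abs_less_1_iff_floor)
qed

text \<open>One-dimensional Helly property: any point between the largest left end and the smallest
  right end works. The case \<open>i = j\<close> says that each interval is nonempty.\<close>

lemma finite_intervals_common_point:
  fixes l :: "'i \<Rightarrow> real" and u :: "'i \<Rightarrow> real"
  assumes "finite S" "\<And>i j. i \<in> S \<Longrightarrow> j \<in> S \<Longrightarrow> l i < u j"
  shows "\<exists>p. \<forall>i\<in>S. l i < p \<and> p < u i"
proof (cases "S = {}")
  case False
  with assms have "Max (l ` S) < Min (u ` S)"
    by simp
  then obtain p where "Max (l ` S) < p" "p < Min (u ` S)"
    using dense by blast
  with assms False show ?thesis
    by (auto intro!: exI[of _ p])
qed simp

text \<open>The margin \<epsilon> must be uniform in \<open>n\<close>. Near infinity the floors are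
  constant, since the limit differences are not integers, so one value serves the whole tail and
  only finitely many coordinates need their own. The margin later absorbs both the density
  approximation and the move made by \<open>gec\<close>.\<close>

lemma exists_sequence_with_floors:
  fixes S :: "((nat \<Rightarrow>\<^sub>C real) \<times> (nat \<Rightarrow>\<^sub>C real)) set"
  assumes "finite S" "x \<in> c_space" "S \<subseteq> c_space \<times> c_space"
    and nonint: "\<And>y v n. (y, v) \<in> S \<Longrightarrow> coord x n - coord y n \<notin> \<int>"
    and floors: "\<And>y v y' v' n. (y, v) \<in> S \<Longrightarrow> (y', v') \<in> S
      \<Longrightarrow> \<lfloor>coord y n - coord y' n\<rfloor> = \<lfloor>coord v n - coord v' n\<rfloor>"
  shows "\<exists>w\<in>c_space. \<exists>\<epsilon>>0. \<forall>z\<in>c_space. norm (z - w) < \<epsilon> \<longrightarrow>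
    (\<forall>y v n. (y, v) \<in> S \<longrightarrow> coord z n - coord v n \<notin> \<int> \<and>
      \<lfloor>coord z n - coord v n\<rfloor> = \<lfloor>coord x n - coord y n\<rfloor>)"
proof -
  \<comment> \<open>Left end of the open unit interval in which coordinate \<open>n\<close> of the
    new point must lie.\<close>
  define l where "l n p = coord (snd p) n + of_int \<lfloor>coord x n - coord (fst p) n\<rfloor>" for n p
  have "l n p < l n q + 1" if pq: "p \<in> S" "q \<in> S" for n p q
  proof -
    obtain y v y' v' where [simp]: "p = (y, v)" "q = (y', v')" by fastforce
    define k k' where "k = \<lfloor>coord x n - coord y n\<rfloor>" and "k' = \<lfloor>coord x n - coord y' n\<rfloor>"
    \<comment> \<open>The bound is an integer, so whether it holds depends only on the floor of the
      difference; this is how it passes from \<open>y\<close>, \<open>y'\<close> to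
      \<open>v\<close>, \<open>v'\<close>.\<close>
    have "coord y n - coord y' n < of_int (k' - k + 1)"
      unfolding k_def k'_def by linarith
    then have "\<lfloor>coord y n - coord y' n\<rfloor> < k' - k + 1"
      by (simp only: floor_less_iff)
    then have "\<lfloor>coord v n - coord v' n\<rfloor> < k' - k + 1"
      using floors[of y v y' v' n] pq by simp
    then have "coord v n - coord v' n < of_int (k' - k + 1)"
      by (simp only: floor_less_iff)
    then show ?thesis
      by (simp add: l_def k_def k'_def)
  qed
  then have "\<exists>c. \<forall>p\<in>S. l n p < c \<and> c < l n p + 1" for n
    by (intro finite_intervals_common_point \<open>finite S\<close>)
  then obtain c where c: "\<And>n p. p \<in> S \<Longrightarrow> l n p < c n \<and> c n < l n p + 1"
    by metis
  \<comment> \<open>Finiteness of \<open>S\<close> gives a common margin. Stating it for all small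
    positive \<epsilon> lets finitely many coordinates share one margin later.\<close>
  have room: "\<forall>\<^sub>F \<epsilon> in at_right 0. \<forall>p\<in>S. l n p + \<epsilon> < c n \<and> c n < l n p + 1 - \<epsilon>" for n
  proof (intro eventually_ball_finite[OF \<open>finite S\<close>] ballI)
    fix p assume p: "p \<in> S"
    then have "\<forall>\<^sub>F \<epsilon> in at_right 0. \<epsilon> < min (c n - l n p) (l n p + 1 - c n)"
      using c[OF p] by (intro order_tendstoD(2)[OF tendsto_ident_at]) simp
    then show "\<forall>\<^sub>F \<epsilon> in at_right 0. l n p + \<epsilon> < c n \<and> c n < l n p + 1 - \<epsilon>"
      by eventually_elim auto
  qed
  obtain \<delta> where \<delta>: "\<delta> > 0" "\<And>p. p \<in> S \<Longrightarrow> l \<infinity> p + \<delta> < c \<infinity> \<and> c \<infinity> < l \<infinity> p + 1 - \<delta>"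
    using eventually_happens[OF eventually_conj[OF room[of \<infinity>] eventually_at_right_less[of 0]]]
    by auto
  \<comment> \<open>The strict inequalities at infinity persist for large \<open>n\<close> with the
    same \<delta> and the same point \<open>c \<infinity>\<close>: the floors stabilize and the
    coordinates of \<open>v\<close> converge.\<close>
  have "\<forall>\<^sub>F n in sequentially. \<forall>p\<in>S. l (enat n) p + \<delta> < c \<infinity> \<and> c \<infinity> < l (enat n) p + 1 - \<delta>"
  proof (intro eventually_ball_finite[OF \<open>finite S\<close>] ballI)
    fix p assume p: "p \<in> S"
    obtain y v where [simp]: "p = (y, v)" by fastforce
    have yv: "y \<in> c_space" "v \<in> c_space"
      using p assms(3) by auto
    have "(\<lambda>n. coord x (enat n) - coord y (enat n)) \<longlonglongrightarrow> coord x \<infinity> - coord y \<infinity>"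
      using yv assms(2) by (intro tendsto_diff coord_tendsto)
    then have "\<forall>\<^sub>F n in sequentially.
        \<lfloor>coord x (enat n) - coord y (enat n)\<rfloor> = \<lfloor>coord x \<infinity> - coord y \<infinity>\<rfloor>"
      using nonint p by (intro eventually_floor_eq) auto
    moreover have "\<forall>\<^sub>F n in sequentially. coord v (enat n) <
        c \<infinity> - \<delta> - of_int \<lfloor>coord x \<infinity> - coord y \<infinity>\<rfloor>"
      using \<delta>(2)[OF p] by (intro order_tendstoD(2)[OF coord_tendsto[OF yv(2)]]) (simp add: l_def)
    moreover have "\<forall>\<^sub>F n in sequentially.
        c \<infinity> + \<delta> - 1 - of_int \<lfloor>coord x \<infinity> - coord y \<infinity>\<rfloor> < coord v (enat n)"
      using \<delta>(2)[OF p] by (intro order_tendstoD(1)[OF coord_tendsto[OF yv(2)]]) (simp add: l_def)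
    ultimately show "\<forall>\<^sub>F n in sequentially.
        l (enat n) p + \<delta> < c \<infinity> \<and> c \<infinity> < l (enat n) p + 1 - \<delta>"
      by eventually_elim (auto simp: l_def)
  qed
  then obtain N where N: "\<And>n p. n \<ge> N \<Longrightarrow> p \<in> S \<Longrightarrow>
      l (enat n) p + \<delta> < c \<infinity> \<and> c \<infinity> < l (enat n) p + 1 - \<delta>"
    by (auto simp: eventually_sequentially)
  have "\<forall>\<^sub>F \<epsilon> in at_right 0. \<forall>n\<in>{..<N}. \<forall>p\<in>S.
      l (enat n) p + \<epsilon> < c (enat n) \<and> c (enat n) < l (enat n) p + 1 - \<epsilon>"
    using room by (intro eventually_ball_finite) auto
  then obtain \<eta> where \<eta>: "\<eta> > 0" "\<And>n p. n < N \<Longrightarrow> p \<in> S \<Longrightarrow>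
      l (enat n) p + \<eta> < c (enat n) \<and> c (enat n) < l (enat n) p + 1 - \<eta>"
    using eventually_happens[OF eventually_conj[OF _ eventually_at_right_less[of 0]]] by force
  \<comment> \<open>Individual choices before \<open>N\<close> and a constant tail make the sequence
    convergent.\<close>
  define s where "s n = (if n < N then c (enat n) else c \<infinity>)" for n
  have "s \<longlonglongrightarrow> c \<infinity>"
    by (rule tendsto_eventually) (auto simp: s_def eventually_sequentially intro!: exI[of _ N])
  then obtain w where w: "w \<in> c_space" "apply_bcontfun w = s"
    using convergent_imp_c_space convergentI by metis
  have w_inf: "coord w \<infinity> = c \<infinity>"
    using \<open>s \<longlonglongrightarrow> c \<infinity>\<close> w by (simp add: coord_def limI)
  define \<epsilon> where "\<epsilon> = min \<delta> \<eta>"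
  have \<epsilon>: "l n p + \<epsilon> < coord w n \<and> coord w n < l n p + 1 - \<epsilon>" if "p \<in> S" for n p
  proof (cases n)
    case (enat k)
    then show ?thesis
      using N[of k p] \<eta>(2)[of k p] that w(2) by (auto simp: coord_def s_def \<epsilon>_def)
  next
    case infinity
    then show ?thesis
      using \<delta>(2)[OF that] w_inf by (auto simp: \<epsilon>_def)
  qed
  have "coord z n - coord v n \<notin> \<int> \<and> \<lfloor>coord z n - coord v n\<rfloor> = \<lfloor>coord x n - coord y n\<rfloor>"
    if z: "z \<in> c_space" "norm (z - w) < \<epsilon>" and yv: "(y, v) \<in> S" for z y v n
  proof -
    have "z - w \<in> c_space"
      using z w subspace_c_space subspace_diff by blast
    then have "\<bar>coord z n - coord w n\<bar> < \<epsilon>"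
      using abs_coord_le_norm[of "z - w" n] z w by (simp add: coord_diff)
    then have *: "of_int \<lfloor>coord x n - coord y n\<rfloor> < coord z n - coord v n"
      "coord z n - coord v n < of_int \<lfloor>coord x n - coord y n\<rfloor> + 1"
      using \<epsilon>[OF yv, of n] unfolding l_def fst_conv snd_conv abs_less_iff by linarith+
    then have "\<lfloor>coord z n - coord v n\<rfloor> = \<lfloor>coord x n - coord y n\<rfloor>"
      by (simp add: floor_eq_iff)
    moreover from this have "coord z n - coord v n \<notin> \<int>"
      using * by (metis Ints_cases floor_of_int less_irrefl)
    ultimately show ?thesis by blast
  qed
  moreover have "\<epsilon> > 0"
    using \<delta> \<eta> by (simp add: \<epsilon>_def)
  ultimately show ?thesis
    using w(1) by blast
qed

section \<open>Extending a partial isomorphism\<close>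

lemma adjacent_commute: "adjacent G u v \<longleftrightarrow> adjacent G v u"
  by (simp add: adjacent_def insert_commute)

lemma adjacent_irrefl: "is_graph G \<Longrightarrow> \<not> adjacent G u u"
  by (auto simp: is_graph_def adjacent_def doubleton_eq_iff subset_iff)

text \<open>The relation fed to \<open>back_and_forth\<close>. When the differences are not
  integers, the floors determine which vertices are closer than 1, hence where the threshold permits
  an edge.\<close>

definition compatible ::
  "(nat \<Rightarrow>\<^sub>C real) sgraph \<Rightarrow> (nat \<Rightarrow>\<^sub>C real) sgraph \<Rightarrow>
    (nat \<Rightarrow>\<^sub>C real) \<times> (nat \<Rightarrow>\<^sub>C real) \<Rightarrow> (nat \<Rightarrow>\<^sub>C real) \<times> (nat \<Rightarrow>\<^sub>C real) \<Rightarrow> bool" where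
  "compatible G H p q \<longleftrightarrow> (fst p = fst q \<longleftrightarrow> snd p = snd q) \<and>
     (adjacent G (fst p) (fst q) \<longleftrightarrow> adjacent H (snd p) (snd q)) \<and>
     (\<forall>n. \<lfloor>coord (fst p) n - coord (fst q) n\<rfloor> = \<lfloor>coord (snd p) n - coord (snd q) n\<rfloor>)"

lemma compatible_swap: "compatible H G (prod.swap p) (prod.swap q) \<longleftrightarrow> compatible G H p q"
  by (auto simp: compatible_def)

text \<open>Every vertex within \<epsilon> of the sequence \<open>w\<close> has the right floors.
  Density finds such a vertex \<open>z0\<close>, and \<open>gec\<close> corrects its adjacencies
  without leaving that ball.\<close>

lemma compatible_extend:
  assumes G: "nonint_diff (verts G)" "geometric_1_graph G"
    and H: "dense_in_c (verts H)" "geometric_1_graph H"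
    and S: "finite S" "S \<subseteq> verts G \<times> verts H" "\<forall>p\<in>S. \<forall>q\<in>S. compatible G H p q"
    and x: "x \<in> verts G" "x \<notin> fst ` S"
  shows "\<exists>w\<in>verts H. \<forall>p\<in>insert (x, w) S. \<forall>q\<in>insert (x, w) S. compatible G H p q"
proof -
  have sub: "verts G \<subseteq> c_space" "verts H \<subseteq> c_space"
    using G H by (auto simp: nonint_diff_def dense_in_c_def)
  have nonint: "coord x n - coord y n \<notin> \<int>" if "(y, v) \<in> S" for y v n
  proof -
    have "y \<noteq> x" "y \<in> verts G" using that x S(2) by force+
    then show ?thesis using G(1) x(1) by (auto simp: nonint_diff_def)
  qed
  have "\<exists>w\<in>c_space. \<exists>\<epsilon>>0. \<forall>z\<in>c_space. norm (z - w) < \<epsilon> \<longrightarrow>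
    (\<forall>y v n. (y, v) \<in> S \<longrightarrow> coord z n - coord v n \<notin> \<int> \<and>
      \<lfloor>coord z n - coord v n\<rfloor> = \<lfloor>coord x n - coord y n\<rfloor>)"
  proof (rule exists_sequence_with_floors)
    show "S \<subseteq> c_space \<times> c_space" using S(2) sub by blast
    show "x \<in> c_space" using x sub by blast
    show "\<lfloor>coord y n - coord y' n\<rfloor> = \<lfloor>coord v n - coord v' n\<rfloor>"
      if "(y, v) \<in> S" "(y', v') \<in> S" for y v y' v' n
      using bspec[OF bspec[OF S(3) that(1)] that(2)] by (simp add: compatible_def)
  qed (use S(1) nonint in auto)
  then obtain w \<epsilon> where w: "w \<in> c_space" and "\<epsilon> > 0"
    and floors: "\<And>z y v n. \<lbrakk>z \<in> c_space; norm (z - w) < \<epsilon>; (y, v) \<in> S\<rbrakk> \<Longrightarrow>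
      coord z n - coord v n \<notin> \<int> \<and> \<lfloor>coord z n - coord v n\<rfloor> = \<lfloor>coord x n - coord y n\<rfloor>"
    by blast
  have norm_cong: "norm (z - v) < 1 \<longleftrightarrow> norm (x - y) < 1"
    if "z \<in> c_space" "norm (z - w) < \<epsilon>" "(y, v) \<in> S" for z y v
  proof (rule norm_diff_less_1_cong)
    show "x \<in> c_space" "y \<in> c_space" "v \<in> c_space" using that S(2) x sub by auto
  qed (use that nonint floors in auto)
  have "w \<in> closure (verts H)"
    using H(1) w by (auto simp: dense_in_c_def)
  \<comment> \<open>Half of \<epsilon> is kept for the step from \<open>z0\<close> to
    \<open>z\<close>.\<close>
  then obtain z0 where z0: "z0 \<in> verts H" "norm (z0 - w) < \<epsilon> / 2"
    using \<open>\<epsilon> > 0\<close> by (metis closure_approachable dist_norm half_gt_zero)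
  define A where "A = snd ` {p\<in>S. adjacent G x (fst p)}"
  \<comment> \<open>Only non-neighbours closer than 1 enter \<open>B\<close>, because
    \<open>gec\<close> requires the sets to lie in the unit ball of \<open>z0\<close>. Farther
    vertices are nonadjacent by the threshold.\<close>
  define B where "B = snd ` {p\<in>S. \<not> adjacent G x (fst p) \<and> norm (x - fst p) < 1}"
  have adj_norm: "norm (x - y) < 1" if "adjacent G x y" "(y, v) \<in> S" for y v
    using that x S(2) G(2) by (auto simp: geometric_1_graph_def threshold_1_def)
  have "A \<inter> B = {}"
  proof -
    have "fst p = fst q" if "p \<in> S" "q \<in> S" "snd p = snd q" for p q
      using S(3) that by (auto simp: compatible_def)
    then show ?thesis unfolding A_def B_def by fastforce
  qed
  moreover have "A \<union> B \<subseteq> ball z0 1"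
  proof -
    have "norm (z0 - v) < 1" if "(y, v) \<in> S" "norm (x - y) < 1" for y v
      using that norm_cong[of z0 y v] z0 sub \<open>\<epsilon> > 0\<close> by auto
    then show ?thesis
      using adj_norm by (auto simp: A_def B_def dist_norm)
  qed
  moreover have "A \<subseteq> verts H" "B \<subseteq> verts H" "finite A" "finite B"
    using S(1,2) by (auto simp: A_def B_def)
  \<comment> \<open>The cap 1/2 keeps the parameter of \<open>gec\<close> below 1 when \<epsilon> is
    large.\<close>
  moreover have "0 < min (\<epsilon> / 2) (1 / 2)" "min (\<epsilon> / 2) (1 / 2) < 1"
    using \<open>\<epsilon> > 0\<close> by auto
  moreover have "gec H"
    using H(2) by (simp add: geometric_1_graph_def)
  ultimately obtain z where z: "z \<in> verts H" "\<forall>a\<in>A. adjacent H z a" "\<forall>b\<in>B. \<not> adjacent H z b"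
    "norm (z0 - z) < min (\<epsilon> / 2) (1 / 2)"
    using z0(1) unfolding gec_def by (metis (no_types, lifting) Diff_iff)
  have zw: "norm (z - w) < \<epsilon>"
    using z(4) z0(2) norm_triangle_ineq[of "z - z0" "z0 - w"] by (simp add: norm_minus_commute)
  have zc: "z \<in> c_space" using z sub by blast
  have "compatible G H (x, z) (y, v) \<and> compatible G H (y, v) (x, z)" if yv: "(y, v) \<in> S" for y v
  proof -
    have "y \<noteq> x" using yv x by force
    \<comment> \<open>If they were equal, their coordinate difference would be the integer
      0.\<close>
    moreover have "z \<noteq> v" using floors[OF zc zw yv, of 0] by auto
    moreover have "adjacent G x y \<longleftrightarrow> adjacent H z v"
    proof (cases "norm (x - y) < 1")
      case True
      then have "adjacent G x y \<Longrightarrow> v \<in> A" "\<not> adjacent G x y \<Longrightarrow> v \<in> B"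
        using yv by (force simp: A_def B_def)+
      then show ?thesis using z by blast
    next
      case False
      then have "\<not> norm (z - v) < 1" using norm_cong zc zw yv by blast
      then have "\<not> adjacent H z v"
        using H(2) z(1) yv S(2) by (auto simp: geometric_1_graph_def threshold_1_def)
      then show ?thesis using adj_norm[OF _ yv] False by blast
    qed
    moreover have "\<lfloor>coord y n - coord x n\<rfloor> = \<lfloor>coord v n - coord z n\<rfloor>" for n
      using floor_minus_cong[of "coord x n - coord y n" "coord z n - coord v n"]
        nonint[OF yv] floors[OF zc zw yv] by simp
    ultimately show ?thesis
      using floors[OF zc zw yv] adjacent_commute[of G x y] adjacent_commute[of H z v]
      by (auto simp: compatible_def)
  qed
  moreover have "compatible G H (x, z) (x, z)"
    using G(2) H(2) by (simp add: compatible_def adjacent_irrefl geometric_1_graph_def)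
  ultimately show ?thesis
    using z(1) S(3) by (intro bexI[of _ z]) auto
qed

section \<open>Assembling the isomorphism\<close>

theorem theorem4p2:
  fixes V W :: "(nat \<Rightarrow>\<^sub>C real) set" and G H :: "(nat \<Rightarrow>\<^sub>C real) sgraph"
  assumes "dense_in_c V" and "countable V" and "idf V"
    and "dense_in_c W" and "countable W" and "idf W"
    and "geometric_1_graph G" and "verts G = V"
    and "geometric_1_graph H" and "verts H = W"
  shows "graph_isomorphic G H"
proof -
  have nonint: "nonint_diff (verts G)" "nonint_diff (verts H)"
    using assms by (auto simp: idf_def nonint_diff_def)
  have "\<exists>f. bij_betw f V W \<and> (\<forall>x\<in>V. \<forall>y\<in>V. compatible G H (x, f x) (y, f y))"
  proof (rule back_and_forth)
    fix S x
    assume "finite S" "S \<subseteq> V \<times> W" "\<forall>p\<in>S. \<forall>q\<in>S. compatible G H p q" "x \<in> V" "x \<notin> fst ` S"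
    then show "\<exists>w\<in>W. \<forall>p\<in>insert (x, w) S. \<forall>q\<in>insert (x, w) S. compatible G H p q"
      using compatible_extend[of G H S x] nonint assms by auto
  next
    fix S w
    assume S: "finite S" "S \<subseteq> V \<times> W" "\<forall>p\<in>S. \<forall>q\<in>S. compatible G H p q" "w \<in> W" "w \<notin> snd ` S"
    \<comment> \<open>The backward step is the forward step with \<open>G\<close> and
      \<open>H\<close> exchanged and all pairs swapped.\<close>
    have "\<exists>x\<in>verts G. \<forall>p\<in>insert (w, x) (prod.swap ` S). \<forall>q\<in>insert (w, x) (prod.swap ` S).
        compatible H G p q"
    proof (rule compatible_extend)
      show "\<forall>p\<in>prod.swap ` S. \<forall>q\<in>prod.swap ` S. compatible H G p q"
        using S(3) by (auto simp del: swap_simp simp: compatible_swap)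
    qed (use S assms nonint in \<open>auto simp: image_image\<close>)
    then obtain x where x: "x \<in> V" "\<forall>p\<in>prod.swap ` insert (x, w) S.
        \<forall>q\<in>prod.swap ` insert (x, w) S. compatible H G p q"
      using assms by auto
    then have "\<forall>p\<in>insert (x, w) S. \<forall>q\<in>insert (x, w) S. compatible G H p q"
      by (metis compatible_swap imageI)
    with x(1) show "\<exists>x\<in>V. \<forall>p\<in>insert (x, w) S. \<forall>q\<in>insert (x, w) S. compatible G H p q"
      by blast
  qed (use assms in \<open>auto simp: compatible_def\<close>)
  then show ?thesis
    using assms by (auto simp: graph_isomorphic_def compatible_def)
qed

end
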